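(* Let $N\ge 2$. For $\phi\in\mathbb{R}$ let $|\Psi_\phi\rangle=\frac{1}{\sqrt2}\left(|0\rangle^{\otimes N}+e^{i\phi}|1\rangle^{\otimes N}\right)\in(\mathbb{C}^2)^{\otimes N}$ and $$\mathcal{W}_{\Psi_\phi}=\tfrac12\,\mathbb{I}-|\Psi_\phi\rangle\langle\Psi_\phi| .$$ Then the whole family $\{\mathcal{W}_{\Psi_\phi}\}_{\phi\in\mathbb{R}}$ can be realized with the same (independent of $\phi$) $N+2$ local measurement settings, namely $\sigma_z^{\otimes N}$ and $$\mathcal{M}_{\theta_k}=\left(\cos\theta_k\,\sigma_x+\sin\theta_k\,\sigma_y\right)^{\otimes N},\qquad \theta_k=\frac{k\pi}{N+1},\quad k=0,1,\dots,N .$$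
   Context: The Hilbert space is that of $N$ qubits, $(\mathbb{C}^2)^{\otimes N}$, with computational basis built from $|0\rangle,|1\rangle$; $\sigma_x,\sigma_y,\sigma_z$ are the Pauli matrices and $\mathbb{I}$ is the identity. Local measurement setting (LMS): for single-qubit Hermitian operators $O_1,\dots,O_N$, each with eigenvalues $\pm1$, the LMS $O_1\otimes\cdots\otimes O_N$ means measuring each qubit $j$ in the eigenbasis of $O_j$ and recording all $N$ outcomes. Its outcome probabilities on a state $\rho$ are $\mathrm{Tr}(\Pi_a\rho)$, where for $a=(a_1,\dots,a_N)\in\{\pm1\}^N$, $\Pi_a=\bigotimes_{j=1}^N\frac{\mathbb{I}+a_jO_j}{2}$. A Hermitian operator $\mathcal{W}$ is realized with a given finite collection of LMSs if it is a real linear combination of the projectors $\Pi_a$ belonging to the settings in the collection (so that, for every state $\rho$, $\mathrm{Tr}(\mathcal{W}\rho)$ is obtained by linear postprocessing of the outcome probabilities of these settings). A family of operators is realized with the collection if each member is, the coefficients being allowed to depend on the member. *)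

theory Defs
  imports "Jordan_Normal_Form.Spectral_Radius" "Jordan_Normal_Form.Schur_Decomposition"
begin

text \<open>
  Operators on \<open>N\<close> qubits are complex \<open>2^N \<times> 2^N\<close> matrices, and kets are one-column
  matrices.  The rows are indexed by the computational basis in binary, the first qubit being the
  most significant digit, which is the order produced by the Kronecker product.
\<close>

definition kron :: "complex mat \<Rightarrow> complex mat \<Rightarrow> complex mat" where
  "kron A B = mat (dim_row A * dim_row B) (dim_col A * dim_col B)
     (\<lambda>(i, j). A $$ (i div dim_row B, j div dim_col B) * B $$ (i mod dim_row B, j mod dim_col B))"

definition tensor :: "complex mat list \<Rightarrow> complex mat" where
  "tensor As = foldr kron As (1\<^sub>m 1)"

definition hermitian :: "complex mat \<Rightarrow> bool" where
  "hermitian A \<longleftrightarrow> square_mat A \<and> mat_adjoint A = A"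

definition sigma_x :: "complex mat" where
  "sigma_x = mat_of_rows_list 2 [[0, 1], [1, 0]]"

definition sigma_y :: "complex mat" where
  "sigma_y = mat_of_rows_list 2 [[0, - \<i>], [\<i>, 0]]"

definition sigma_z :: "complex mat" where
  "sigma_z = mat_of_rows_list 2 [[1, 0], [0, - 1]]"

definition ket0 :: "complex mat" where
  "ket0 = mat_of_rows_list 1 [[1], [0]]"

definition ket1 :: "complex mat" where
  "ket1 = mat_of_rows_list 1 [[0], [1]]"

text \<open>
  A local measurement setting \<open>O\<^sub>1 \<otimes> \<dots> \<otimes> O\<^sub>N\<close> is represented by the list of its local
  observables (and not by the product operator): this is the data that determines the
  \<open>2^N\<close> outcomes and their projectors.
\<close>

definition local_setting :: "nat \<Rightarrow> complex mat list \<Rightarrow> bool" where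
  "local_setting N Os \<longleftrightarrow> length Os = N \<and>
     (\<forall>A\<in>set Os. A \<in> carrier_mat 2 2 \<and> hermitian A \<and> spectrum A = {1, - 1})"

definition outcomes :: "nat \<Rightarrow> real list set" where
  "outcomes N = {a. length a = N \<and> set a \<subseteq> {1, - 1}}"

definition outcome_projector :: "complex mat list \<Rightarrow> real list \<Rightarrow> complex mat" where
  "outcome_projector Os a =
     tensor (map2 (\<lambda>A s. (1 / 2) \<cdot>\<^sub>m (1\<^sub>m 2 + complex_of_real s \<cdot>\<^sub>m A)) Os a)"

text \<open>
  The type of matrices has no zero that is independent of the dimensions, so the linear
  combination is a \<open>finsum\<close> in the module of \<open>2^N \<times> 2^N\<close> matrices.
\<close>

definition realized_with :: "nat \<Rightarrow> complex mat list set \<Rightarrow> complex mat \<Rightarrow> bool" where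
  "realized_with N S W \<longleftrightarrow>
     finite S \<and> (\<forall>Os\<in>S. local_setting N Os) \<and>
     W \<in> carrier_mat (2 ^ N) (2 ^ N) \<and> hermitian W \<and>
     (\<exists>c :: complex mat list \<Rightarrow> real list \<Rightarrow> real.
        W = finsum (module_mat TYPE(complex) (2 ^ N) (2 ^ N))
              (\<lambda>(Os, a). complex_of_real (c Os a) \<cdot>\<^sub>m outcome_projector Os a)
              (S \<times> outcomes N))"

definition family_realized_with :: "nat \<Rightarrow> complex mat list set \<Rightarrow> complex mat set \<Rightarrow> bool" where
  "family_realized_with N S \<W> \<longleftrightarrow> (\<forall>W\<in>\<W>. realized_with N S W)"

definition ghz_ket :: "nat \<Rightarrow> real \<Rightarrow> complex mat" where
  "ghz_ket N \<phi> = complex_of_real (1 / sqrt 2) \<cdot>\<^sub>m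
     (tensor (replicate N ket0) + exp (\<i> * complex_of_real \<phi>) \<cdot>\<^sub>m tensor (replicate N ket1))"

definition ghz_witness :: "nat \<Rightarrow> real \<Rightarrow> complex mat" where
  "ghz_witness N \<phi> = (1 / 2) \<cdot>\<^sub>m 1\<^sub>m (2 ^ N) - ghz_ket N \<phi> * mat_adjoint (ghz_ket N \<phi>)"

definition Z_setting :: "nat \<Rightarrow> complex mat list" where
  "Z_setting N = replicate N sigma_z"

definition M_setting :: "nat \<Rightarrow> real \<Rightarrow> complex mat list" where
  "M_setting N \<theta> = replicate N
     (complex_of_real (cos \<theta>) \<cdot>\<^sub>m sigma_x + complex_of_real (sin \<theta>) \<cdot>\<^sub>m sigma_y)"

end

theory Submission
  imports Defs
begin

text \<open>
  The diagonal of the witness is a combination of the identity and the two extreme outcomes of the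
  \<open>\<sigma>\<^sub>z\<close> setting.  For the rest, \<open>M\<^sub>\<theta>\<close> is the combination of its outcome projectors
  weighted by the parity of the outcome; it lives on the antidiagonal, where the entry in the row of
  Hamming weight \<open>m\<close> is \<open>e\<^bsup>i\<theta>(2m-N)\<^esup>\<close>.  With \<open>\<theta>\<^sub>k = k\<pi>/(N+1)\<close>, multiplying by
  \<open>2 cos (\<phi> - N\<theta>\<^sub>k) = e\<^bsup>i(\<phi>-N\<theta>\<^sub>k)\<^esup> + e\<^bsup>-i(\<phi>-N\<theta>\<^sub>k)\<^esup>\<close> and summing over \<open>k\<close>
  gives sums of powers of the \<open>(N+1)\<close>-st roots of unity \<open>e\<^bsup>2\<pi>i(m-N)/(N+1)\<^esup>\<close> and
  \<open>e\<^bsup>2\<pi>im/(N+1)\<^esup>\<close>, which vanish except for \<open>m = N\<close> and \<open>m = 0\<close> respectively.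
  What survives is \<open>N+1\<close> times the two corner entries \<open>e\<^bsup>i\<phi>\<^esup>\<close> and
  \<open>e\<^bsup>-i\<phi>\<^esup>\<close>.
\<close>

subsection \<open>Entries of matrices and tensor products\<close>

lemma mat_adjoint_carrier:
  assumes "A \<in> carrier_mat n m"
  shows "mat_adjoint A \<in> carrier_mat m n"
  using assms by (auto simp: mat_adjoint_def)

lemma index_mat_adjoint:
  assumes "A \<in> carrier_mat n m" "i < m" "j < n"
  shows "mat_adjoint A $$ (i, j) = conjugate (A $$ (j, i))"
  using assms by (auto simp: mat_adjoint_def mat_of_rows_index)

lemma hermitianI:
  assumes "A \<in> carrier_mat n n"
    and "\<And>i j. i < n \<Longrightarrow> j < n \<Longrightarrow> cnj (A $$ (j, i)) = A $$ (i, j)"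
  shows "hermitian A"
  unfolding hermitian_def
proof
  show "square_mat A" using assms(1) by auto
  show "mat_adjoint A = A"
    using mat_adjoint_carrier[OF assms(1)] assms
    by (intro eq_matI) (auto simp: index_mat_adjoint[OF assms(1)])
qed

text \<open>Matrix addition is entrywise, so the \<open>finsum\<close> in
  \<open>realized_with\<close> can be read entry by entry, and the matrix identity becomes one
  between complex sums. Closure under summation supplies the dimensions that the entry rule for a
  sum requires.\<close>

lemma finsum_module_mat:
  assumes "finite F" "\<And>x. x \<in> F \<Longrightarrow> f x \<in> carrier_mat n m"
  shows "finsum (module_mat TYPE('a::comm_ring_1) n m) f F \<in> carrier_mat n m"
    and "i < n \<Longrightarrow> j < m \<Longrightarrow>
      finsum (module_mat TYPE('a) n m) f F $$ (i, j) = (\<Sum>x\<in>F. f x $$ (i, j))"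
proof -
  interpret abelian_group "module_mat TYPE('a) n m" by (rule abelian_group_mat)
  have closed: "finsum (module_mat TYPE('a) n m) f G \<in> carrier_mat n m" if "G \<subseteq> F" for G
    using finsum_closed[of f G] assms(2) that by (auto simp: module_mat_simps Pi_def)
  show "finsum (module_mat TYPE('a) n m) f F \<in> carrier_mat n m"
    using closed by simp
  show "finsum (module_mat TYPE('a) n m) f F $$ (i, j) = (\<Sum>x\<in>F. f x $$ (i, j))"
    if ij: "i < n" "j < m"
    using assms
  proof (induction F rule: finite_induct)
    case empty
    then show ?case using ij by (simp add: module_mat_simps)
  next
    case (insert x G)
    have "finsum (module_mat TYPE('a) n m) f G \<in> carrier_mat n m"
      using finsum_closed[of f G] insert.prems by (auto simp: module_mat_simps Pi_def)
    then show ?case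
      using insert ij by (subst finsum_insert) (auto simp: module_mat_simps Pi_def)
  qed
qed

section \<open>Entries of tensor powers, by recursion on the leading binary digit\<close>

lemma tensor_Nil: "tensor [] = 1\<^sub>m 1"
  by (simp add: tensor_def)

lemma tensor_Cons: "tensor (A # As) = kron A (tensor As)"
  by (simp add: tensor_def)

lemma tensor_carrier:
  assumes "set As \<subseteq> carrier_mat r c"
  shows "tensor As \<in> carrier_mat (r ^ length As) (c ^ length As)"
  using assms by (induction As) (auto simp: tensor_Nil tensor_Cons kron_def)

lemma index_tensor_Cons:
  assumes "A \<in> carrier_mat r c" "set As \<subseteq> carrier_mat r c"
    and "i < r ^ Suc (length As)" "j < c ^ Suc (length As)"
  shows "tensor (A # As) $$ (i, j) =
    A $$ (i div r ^ length As, j div c ^ length As) *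
    tensor As $$ (i mod r ^ length As, j mod c ^ length As)"
  using assms tensor_carrier[OF assms(2)] by (auto simp: tensor_Cons kron_def)

lemma index_tensor_replicate_Suc:
  assumes "A \<in> carrier_mat r c" "i < r ^ Suc n" "j < c ^ Suc n"
  shows "tensor (replicate (Suc n) A) $$ (i, j) =
    A $$ (i div r ^ n, j div c ^ n) * tensor (replicate n A) $$ (i mod r ^ n, j mod c ^ n)"
  using index_tensor_Cons[of A r c "replicate n A" i j] assms
  by (auto simp: set_replicate_conv_if)

text \<open>The quotient by \<open>2 ^ n\<close> is the digit of the first qubit and the remainder
  indexes the other \<open>n\<close> qubits. Each case records both values, so that the tensor
  recursion simplifies directly.\<close>

lemma binary_digit_cases:
  fixes i :: nat
  assumes "i < 2 ^ Suc n"
  obtains i' where "i' < 2 ^ n" "i = i'" "i div 2 ^ n = 0" "i mod 2 ^ n = i'"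
    | i' where "i' < 2 ^ n" "i = 2 ^ n + i'" "i div 2 ^ n = 1" "i mod 2 ^ n = i'"
proof (cases "i < 2 ^ n")
  case True
  then show ?thesis using that(1) by simp
next
  case False
  then have "i - 2 ^ n < 2 ^ n" "i = 2 ^ n + (i - 2 ^ n)" using assms by auto
  moreover have "i div 2 ^ n = 1" "i mod 2 ^ n = i - 2 ^ n"
    using calculation False by (simp_all add: le_div_geq le_mod_geq)
  ultimately show ?thesis using that(2) by blast
qed

lemma index_tensor_one:
  assumes "i < 2 ^ n" "j < 2 ^ n"
  shows "tensor (replicate n (1\<^sub>m 2)) $$ (i, j) = (if i = j then 1 else 0)"
  using assms
proof (induction n arbitrary: i j)
  case 0
  then show ?case by (simp add: tensor_Nil)
next
  case (Suc n)
  show ?case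
    unfolding index_tensor_replicate_Suc[OF one_carrier_mat Suc.prems] using Suc.prems
    by (elim binary_digit_cases) (simp_all add: Suc.IH)
qed

text \<open>The factor is |0><0|, so its tensor power projects onto the all-zero basis
  vector.\<close>

lemma index_tensor_corner0:
  assumes "A \<in> carrier_mat 2 2" "\<And>p q. p < 2 \<Longrightarrow> q < 2 \<Longrightarrow> A $$ (p, q) = (if p = 0 \<and> q = 0 then 1 else 0)"
    and "i < 2 ^ n" "j < 2 ^ n"
  shows "tensor (replicate n A) $$ (i, j) = (if i = 0 \<and> j = 0 then 1 else 0)"
  using assms(3,4)
proof (induction n arbitrary: i j)
  case 0
  then show ?case by (simp add: tensor_Nil)
next
  case (Suc n)
  show ?case
    unfolding index_tensor_replicate_Suc[OF assms(1) Suc.prems] using Suc.prems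
    by (elim binary_digit_cases) (simp_all add: Suc.IH assms(2))
qed

text \<open>The factor is |1><1|, and the all-one basis vector has the last index;
  \<open>Suc i = 2 ^ n\<close> expresses this without subtraction on naturals.\<close>

lemma index_tensor_corner1:
  assumes "A \<in> carrier_mat 2 2" "\<And>p q. p < 2 \<Longrightarrow> q < 2 \<Longrightarrow> A $$ (p, q) = (if p = 1 \<and> q = 1 then 1 else 0)"
    and "i < 2 ^ n" "j < 2 ^ n"
  shows "tensor (replicate n A) $$ (i, j) = (if Suc i = 2 ^ n \<and> Suc j = 2 ^ n then 1 else 0)"
  using assms(3,4)
proof (induction n arbitrary: i j)
  case 0
  then show ?case by (simp add: tensor_Nil)
next
  case (Suc n)
  show ?case
    unfolding index_tensor_replicate_Suc[OF assms(1) Suc.prems] using Suc.prems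
    by (elim binary_digit_cases) (simp_all add: Suc.IH assms(2))
qed

lemma ket_carrier: "ket0 \<in> carrier_mat 2 1" "ket1 \<in> carrier_mat 2 1"
  by (auto simp: ket0_def ket1_def mat_of_rows_list_def)

lemma index_ket:
  "ket0 $$ (0, 0) = 1" "ket0 $$ (Suc 0, 0) = 0" "ket1 $$ (0, 0) = 0" "ket1 $$ (Suc 0, 0) = 1"
  by (auto simp: ket0_def ket1_def mat_of_rows_list_def)

lemma index_tensor_ket0:
  assumes "i < 2 ^ n"
  shows "tensor (replicate n ket0) $$ (i, 0) = (if i = 0 then 1 else 0)"
  using assms
proof (induction n arbitrary: i)
  case 0
  then show ?case by (simp add: tensor_Nil)
next
  case (Suc n)
  have "tensor (replicate (Suc n) ket0) $$ (i, 0) =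
      ket0 $$ (i div 2 ^ n, 0) * tensor (replicate n ket0) $$ (i mod 2 ^ n, 0)"
    using index_tensor_replicate_Suc[OF ket_carrier(1) Suc.prems, of 0] by simp
  then show ?case
    using Suc.prems
    by (elim binary_digit_cases) (simp_all add: Suc.IH index_ket del: replicate_Suc)
qed

lemma index_tensor_ket1:
  assumes "i < 2 ^ n"
  shows "tensor (replicate n ket1) $$ (i, 0) = (if Suc i = 2 ^ n then 1 else 0)"
  using assms
proof (induction n arbitrary: i)
  case 0
  then show ?case by (simp add: tensor_Nil)
next
  case (Suc n)
  have "tensor (replicate (Suc n) ket1) $$ (i, 0) =
      ket1 $$ (i div 2 ^ n, 0) * tensor (replicate n ket1) $$ (i mod 2 ^ n, 0)"
    using index_tensor_replicate_Suc[OF ket_carrier(2) Suc.prems, of 0] by simp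
  then show ?case
    using Suc.prems
    by (elim binary_digit_cases) (simp_all add: Suc.IH index_ket del: replicate_Suc)
qed

section \<open>Observables on the equator of the Bloch sphere\<close>

definition equatorial :: "real \<Rightarrow> complex mat" where
  "equatorial t = complex_of_real (cos t) \<cdot>\<^sub>m sigma_x + complex_of_real (sin t) \<cdot>\<^sub>m sigma_y"

lemma M_setting_eq: "M_setting N t = replicate N (equatorial t)"
  by (simp add: M_setting_def equatorial_def)

lemma equatorial_carrier: "equatorial t \<in> carrier_mat 2 2"
  by (auto simp: equatorial_def sigma_x_def sigma_y_def mat_of_rows_list_def)

lemma index_equatorial:
  "equatorial t $$ (0, 0) = 0" "equatorial t $$ (0, Suc 0) = cis (- t)"
  "equatorial t $$ (Suc 0, 0) = cis t" "equatorial t $$ (Suc 0, Suc 0) = 0"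
  by (auto simp: equatorial_def sigma_x_def sigma_y_def mat_of_rows_list_def complex_eq_iff)

text \<open>Each factor is antidiagonal, so an entry survives only if \<open>j\<close> is the
  bitwise complement of \<open>i\<close>. A row digit 1 contributes \<open>cis t\<close> and a row
  digit 0 contributes \<open>cis (- t)\<close>; the witness \<open>m\<close> is the Hamming weight
  of \<open>i\<close>. Only its extreme values matter later, and it is chosen before
  \<open>t\<close> so that one \<open>m\<close> serves all angles.\<close>

lemma index_tensor_equatorial:
  assumes "i < 2 ^ n" "j < 2 ^ n"
  shows "\<exists>m\<le>n. (m = 0 \<longleftrightarrow> i = 0) \<and> (m = n \<longleftrightarrow> Suc i = 2 ^ n) \<and>
    (\<forall>t. tensor (replicate n (equatorial t)) $$ (i, j) =
      (if Suc (i + j) = 2 ^ n then cis (t * (2 * real m - real n)) else 0))"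
  using assms
proof (induction n arbitrary: i j)
  case 0
  then show ?case by (simp add: tensor_Nil)
next
  case (Suc n)
  let ?i = "i mod 2 ^ n" and ?j = "j mod 2 ^ n"
  obtain m where m: "m \<le> n" "m = 0 \<longleftrightarrow> ?i = 0" "m = n \<longleftrightarrow> Suc ?i = 2 ^ n"
    and IH: "tensor (replicate n (equatorial t)) $$ (?i, ?j) =
      (if Suc (?i + ?j) = 2 ^ n then cis (t * (2 * real m - real n)) else 0)" for t
    using Suc.IH[of ?i ?j] by auto
  have *: "tensor (replicate (Suc n) (equatorial t)) $$ (i, j) =
      equatorial t $$ (i div 2 ^ n, j div 2 ^ n) *
      (if Suc (?i + ?j) = 2 ^ n then cis (t * (2 * real m - real n)) else 0)" for t
    unfolding index_tensor_replicate_Suc[OF equatorial_carrier Suc.prems] IH ..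
  show ?case
    using Suc.prems(1)
  proof (cases rule: binary_digit_cases)
    \<comment> \<open>A leading digit 0 keeps the weight and contributes
      \<open>cis (- t)\<close>.\<close>
    case (1 i')
    have "tensor (replicate (Suc n) (equatorial t)) $$ (i, j) =
      (if Suc (i + j) = 2 ^ Suc n then cis (t * (2 * real m - real (Suc n))) else 0)" for t
      using Suc.prems(2) unfolding *
      by (cases rule: binary_digit_cases)
        (use 1 in \<open>auto simp: index_equatorial cis_mult algebra_simps\<close>)
    then show ?thesis using m 1 by (intro exI[of _ m]) auto
  next
    \<comment> \<open>A leading digit 1 raises the weight by one and contributes
      \<open>cis t\<close>.\<close>
    case (2 i')
    have "tensor (replicate (Suc n) (equatorial t)) $$ (i, j) =
      (if Suc (i + j) = 2 ^ Suc n then cis (t * (2 * real (Suc m) - real (Suc n))) else 0)" for t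
      using Suc.prems(2) unfolding *
      by (cases rule: binary_digit_cases)
        (use 2 in \<open>auto simp: index_equatorial cis_mult algebra_simps\<close>)
    then show ?thesis using m 2 by (intro exI[of _ "Suc m"]) auto
  qed
qed

subsection \<open>Local settings and their outcomes\<close>

text \<open>A traceless 2 by 2 matrix has characteristic polynomial k^2 + det A, and the last
  hypothesis says that det A = -1. This covers both \<open>sigma_z\<close> and the equatorial
  observables.\<close>

lemma spectrum_traceless:
  fixes A :: "complex mat"
  assumes "A \<in> carrier_mat 2 2" "A $$ (1, 1) = - A $$ (0, 0)"
    "A $$ (0, 0) * A $$ (0, 0) + A $$ (0, 1) * A $$ (1, 0) = 1"
  shows "spectrum A = {1, - 1}"
proof -
  have "eigenvalue A k \<longleftrightarrow> k = 1 \<or> k = - 1" for k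
  proof -
    let ?C = "char_matrix A k"
    have C: "?C \<in> carrier_mat 2 2" using assms(1) by (simp add: char_matrix_def)
    have "det ?C = ?C $$ (0, 0) * ?C $$ (1, 1) - ?C $$ (0, 1) * ?C $$ (1, 0)"
      using C by (simp add: laplace_expansion_row[OF C, of 0] numeral_2_eq_2 cofactor_def
          det_single mat_delete_def)
    also have "\<dots> = k\<^sup>2 - (A $$ (0, 0) * A $$ (0, 0) + A $$ (0, 1) * A $$ (1, 0))"
      using assms(1,2) by (simp add: char_matrix_def power2_eq_square algebra_simps)
    finally show ?thesis
      using eigenvalue_det[OF assms(1), of k] assms(3) by (simp add: power2_eq_1_iff)
  qed
  then show ?thesis by (auto simp: spectrum_def)
qed

lemma local_setting_replicate:
  assumes "A \<in> carrier_mat 2 2" "hermitian A" "spectrum A = {1, - 1}"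
  shows "local_setting N (replicate N A)"
  using assms by (auto simp: local_setting_def)

lemma sigma_z_carrier: "sigma_z \<in> carrier_mat 2 2"
  by (auto simp: sigma_z_def mat_of_rows_list_def)

lemma index_sigma_z:
  "sigma_z $$ (0, 0) = 1" "sigma_z $$ (0, Suc 0) = 0"
  "sigma_z $$ (Suc 0, 0) = 0" "sigma_z $$ (Suc 0, Suc 0) = - 1"
  by (auto simp: sigma_z_def mat_of_rows_list_def)

lemma local_setting_Z: "local_setting N (Z_setting N)"
  unfolding Z_setting_def
proof (rule local_setting_replicate[OF sigma_z_carrier])
  show "hermitian sigma_z"
    by (rule hermitianI[OF sigma_z_carrier]) (auto simp: less_2_cases_iff index_sigma_z)
  show "spectrum sigma_z = {1, - 1}"
    by (rule spectrum_traceless[OF sigma_z_carrier]) (simp_all add: index_sigma_z)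
qed

lemma local_setting_M: "local_setting N (M_setting N t)"
  unfolding M_setting_eq
proof (rule local_setting_replicate[OF equatorial_carrier])
  show "hermitian (equatorial t)"
    by (rule hermitianI[OF equatorial_carrier])
      (auto simp: less_2_cases_iff index_equatorial cis_cnj)
  show "spectrum (equatorial t) = {1, - 1}"
    by (rule spectrum_traceless[OF equatorial_carrier]) (simp_all add: index_equatorial cis_mult)
qed

section \<open>Outcome projectors and their product-weighted sums\<close>

definition local_projector :: "complex mat \<Rightarrow> real \<Rightarrow> complex mat" where
  "local_projector A s = (1 / 2) \<cdot>\<^sub>m (1\<^sub>m 2 + complex_of_real s \<cdot>\<^sub>m A)"

lemma local_projector_carrier:
  "A \<in> carrier_mat 2 2 \<Longrightarrow> local_projector A s \<in> carrier_mat 2 2"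
  by (simp add: local_projector_def)

lemma index_local_projector:
  assumes "A \<in> carrier_mat 2 2" "i < 2" "j < 2"
  shows "local_projector A s $$ (i, j) = ((if i = j then 1 else 0) + of_real s * A $$ (i, j)) / 2"
  using assms by (simp add: local_projector_def)

lemma outcome_projector_eq: "outcome_projector Os a = tensor (map2 local_projector Os a)"
  by (simp add: outcome_projector_def local_projector_def[abs_def])

lemma outcomes_0: "outcomes 0 = {[]}"
  by (auto simp: outcomes_def)

lemma outcomes_Suc: "outcomes (Suc n) = Cons 1 ` outcomes n \<union> Cons (- 1) ` outcomes n"
  by (auto simp: outcomes_def length_Suc_conv)

lemma finite_outcomes: "finite (outcomes n)"
  by (induction n) (auto simp: outcomes_0 outcomes_Suc)

lemma sum_outcomes_Suc:
  "(\<Sum>a\<in>outcomes (Suc n). f a) = (\<Sum>a\<in>outcomes n. f (1 # a)) + (\<Sum>a\<in>outcomes n. f (- 1 # a))"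
  unfolding outcomes_Suc
  by (subst sum.union_disjoint) (auto simp: finite_outcomes sum.reindex)

lemma outcome_projector_carrier:
  assumes "local_setting N Os" "a \<in> outcomes N"
  shows "outcome_projector Os a \<in> carrier_mat (2 ^ N) (2 ^ N)"
proof -
  have "set (map2 local_projector Os a) \<subseteq> carrier_mat 2 2"
    using assms(1) local_projector_carrier
    by (auto simp: local_setting_def dest!: set_zip_leftD)
  from tensor_carrier[OF this] assms show ?thesis
    by (simp add: outcome_projector_eq local_setting_def outcomes_def)
qed

text \<open>Both the weight and the projector factor over the qubits, so by distributivity the sum
  over outcomes is the tensor power of the one-qubit sum \<open>B\<close>. Different choices of
  \<open>w\<close> yield the identity, the two corner projectors and the observable itself.\<close>

lemma sum_weighted_outcome_projectors:
  fixes w :: "real \<Rightarrow> real"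
  assumes A: "A \<in> carrier_mat 2 2" and B: "B \<in> carrier_mat 2 2"
    and w: "\<And>p q. p < 2 \<Longrightarrow> q < 2 \<Longrightarrow> B $$ (p, q) =
      of_real (w 1) * local_projector A 1 $$ (p, q) + of_real (w (- 1)) * local_projector A (- 1) $$ (p, q)"
    and "i < 2 ^ n" "j < 2 ^ n"
  shows "(\<Sum>a\<in>outcomes n. of_real (prod_list (map w a)) * outcome_projector (replicate n A) a $$ (i, j))
    = tensor (replicate n B) $$ (i, j)"
  using assms(4,5)
proof (induction n arbitrary: i j)
  case 0
  then show ?case by (simp add: outcomes_0 outcome_projector_def)
next
  case (Suc n)
  let ?i1 = "i div 2 ^ n" and ?j1 = "j div 2 ^ n" and ?i2 = "i mod 2 ^ n" and ?j2 = "j mod 2 ^ n"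
  have lt: "?i1 < 2" "?j1 < 2" using Suc.prems by (simp_all add: less_mult_imp_div_less)
  have step: "outcome_projector (replicate (Suc n) A) (s # a) $$ (i, j) =
      local_projector A s $$ (?i1, ?j1) * outcome_projector (replicate n A) a $$ (?i2, ?j2)"
    if "a \<in> outcomes n" for s a
  proof -
    have "set (map2 local_projector (replicate n A) a) \<subseteq> carrier_mat 2 2"
      using local_projector_carrier[OF A] by (auto dest!: set_zip_leftD)
    moreover have "length (map2 local_projector (replicate n A) a) = n"
      using that by (simp add: outcomes_def)
    ultimately show ?thesis
      using index_tensor_Cons[OF local_projector_carrier[OF A], of "map2 local_projector (replicate n A) a" i j s]
        Suc.prems by (simp add: outcome_projector_eq)
  qed
  \<comment> \<open>With the first outcome fixed at \<open>s\<close>, the induction hypothesis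
    collapses the sum over the others; adding \<open>s = 1\<close> and \<open>s = -1\<close> then
    rebuilds \<open>B\<close> in the first factor.\<close>
  have part: "(\<Sum>a\<in>outcomes n. of_real (prod_list (map w (s # a))) *
        outcome_projector (replicate (Suc n) A) (s # a) $$ (i, j)) =
      of_real (w s) * local_projector A s $$ (?i1, ?j1) * tensor (replicate n B) $$ (?i2, ?j2)" for s
    by (simp add: step Suc.IH[symmetric] sum_distrib_left mult_ac del: replicate_Suc)
  show ?case
    unfolding sum_outcomes_Suc part index_tensor_replicate_Suc[OF B Suc.prems] w[OF lt]
    by (simp add: algebra_simps)
qed

subsection \<open>Fourier filter on the antidiagonal\<close>

text \<open>For nonzero \<open>m\<close> this is a full geometric sum over the powers of a
  nontrivial root of unity of order dividing \<open>N + 1\<close>.\<close>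

lemma cis_root_sum:
  assumes "m \<le> N"
  shows "(\<Sum>k\<le>N. cis (2 * pi * real k * real m / real (Suc N))) = (if m = 0 then of_nat (Suc N) else 0)"
proof (cases "m = 0")
  case False
  define z where "z = cis (2 * pi * real m / real (Suc N))"
  have "z ^ Suc N = cis (2 * pi * real m)"
    unfolding z_def DeMoivre by simp
  then have "z ^ Suc N = 1"
    using cis_multiple_2pi[of "real m"] by simp
  \<comment> \<open>Since \<open>m < N + 1\<close>, the injective enumeration of the roots of unity
    takes the value 1 at \<open>m\<close> only if \<open>m = 0\<close>.\<close>
  moreover have "z \<noteq> 1"
  proof
    assume "z = 1"
    then have eq: "cis (2 * pi * real m / real (Suc N)) = cis (2 * pi * real 0 / real (Suc N))"
      by (simp add: z_def)
    have "inj_on (\<lambda>k. cis (2 * pi * real k / real (Suc N))) {..<Suc N}"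
      using bij_betw_roots_unity[of "Suc N"] unfolding bij_betw_def by blast
    from inj_onD[OF this eq] have "m = 0" using assms by simp
    with False show False by simp
  qed
  ultimately have "(\<Sum>k<Suc N. z ^ k) = 0"
    using geometric_sum[of z "Suc N"] by simp
  moreover have "z ^ k = cis (2 * pi * real k * real m / real (Suc N))" for k
    unfolding z_def DeMoivre by (simp add: mult_ac)
  ultimately show ?thesis using False by (simp add: lessThan_Suc_atMost)
qed simp

text \<open>The coefficients must be real, so the filter is a cosine instead of one exponential. Its
  two halves select the two opposite corners, and the factor 1/2 on the right is that of the
  cosine.\<close>

lemma antidiagonal_filter:
  assumes "m \<le> N"
  shows "(\<Sum>k\<le>N. of_real (cos (\<phi> - real N * (real k * pi / real (N + 1)))) *
      cis (real k * pi / real (N + 1) * (2 * real m - real N))) =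
    of_nat (N + 1) / 2 * ((if m = N then cis \<phi> else 0) + (if m = 0 then cis (- \<phi>) else 0))"
proof -
  let ?t = "\<lambda>k. real k * pi / real (Suc N)"
  \<comment> \<open>The first exponent involves \<open>m - N\<close>, which is not positive;
    conjugation replaces it by the natural number \<open>N - m\<close>, to which
    \<open>cis_root_sum\<close> applies.\<close>
  have summand: "of_real (cos (\<phi> - real N * ?t k)) * cis (?t k * (2 * real m - real N)) =
      (cis \<phi> * cnj (cis (2 * pi * real k * real (N - m) / real (Suc N))) +
       cis (- \<phi>) * cis (2 * pi * real k * real m / real (Suc N))) / 2" for k
  proof -
    have c: "complex_of_real (cos x) = (cis x + cis (- x)) / 2" for x
      by (simp add: complex_eq_iff)
    have 1: "\<phi> - real N * ?t k + ?t k * (2 * real m - real N) =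
        \<phi> - 2 * pi * real k * real (N - m) / real (Suc N)"
    proof -
      have "real N * x - x * (2 * real m - real N) = 2 * x * real (N - m)" for x
        using assms by (simp add: of_nat_diff algebra_simps)
      from this[of "?t k"] show ?thesis by (simp add: mult_ac)
    qed
    have 2: "- (\<phi> - real N * ?t k) + ?t k * (2 * real m - real N) =
        - \<phi> + 2 * pi * real k * real m / real (Suc N)"
    proof -
      have "real N * x + x * (2 * real m - real N) = 2 * x * real m" for x
        by (simp add: algebra_simps)
      from this[of "?t k"] show ?thesis by (simp add: mult_ac)
    qed
    have "of_real (cos (\<phi> - real N * ?t k)) * cis (?t k * (2 * real m - real N)) =
        (cis (\<phi> - real N * ?t k + ?t k * (2 * real m - real N)) +
         cis (- (\<phi> - real N * ?t k) + ?t k * (2 * real m - real N))) / 2"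
      unfolding c cis_mult[symmetric] by (simp add: distrib_right)
    then show ?thesis
      unfolding 1 2 by (simp only: cis_mult cis_cnj diff_conv_add_uminus)
  qed
  have "(\<Sum>k\<le>N. of_real (cos (\<phi> - real N * ?t k)) * cis (?t k * (2 * real m - real N))) =
      (cis \<phi> * cnj (\<Sum>k\<le>N. cis (2 * pi * real k * real (N - m) / real (Suc N))) +
       cis (- \<phi>) * (\<Sum>k\<le>N. cis (2 * pi * real k * real m / real (Suc N)))) / 2"
    unfolding summand sum_divide_distrib[symmetric] sum.distrib sum_distrib_left[symmetric] cnj_sum ..
  also have "\<dots> = of_nat (N + 1) / 2 *
      ((if m = N then cis \<phi> else 0) + (if m = 0 then cis (- \<phi>) else 0))"
    unfolding cis_root_sum[OF assms] cis_root_sum[OF diff_le_self] using assms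
    by (simp add: algebra_simps)
  finally show ?thesis by simp
qed

lemma sum_equatorial_tensors:
  assumes "i < 2 ^ N" "j < 2 ^ N"
  shows "(\<Sum>k\<le>N. of_real (cos (\<phi> - real N * (real k * pi / real (N + 1)))) *
      tensor (replicate N (equatorial (real k * pi / real (N + 1)))) $$ (i, j)) =
    of_nat (N + 1) / 2 * ((if Suc i = 2 ^ N \<and> j = 0 then cis \<phi> else 0) +
      (if i = 0 \<and> Suc j = 2 ^ N then cis (- \<phi>) else 0))"
proof -
  obtain m where m: "m \<le> N" "m = 0 \<longleftrightarrow> i = 0" "m = N \<longleftrightarrow> Suc i = 2 ^ N"
    and e: "tensor (replicate N (equatorial t)) $$ (i, j) =
      (if Suc (i + j) = 2 ^ N then cis (t * (2 * real m - real N)) else 0)" for t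
    using index_tensor_equatorial[OF assms] by blast
  show ?thesis
  proof (cases "Suc (i + j) = 2 ^ N")
    \<comment> \<open>On the antidiagonal the row determines the column, so the extreme weights are
      exactly the two corners.\<close>
    case True
    then have "Suc i = 2 ^ N \<longleftrightarrow> j = 0" "i = 0 \<longleftrightarrow> Suc j = 2 ^ N" by auto
    then show ?thesis
      unfolding e using True antidiagonal_filter[OF m(1), of \<phi>] m(2,3) by simp
  next
    \<comment> \<open>Both corners lie on the antidiagonal, so off it the right-hand side vanishes
      as well.\<close>
    case False
    then show ?thesis unfolding e by auto
  qed
qed

subsection \<open>The GHZ witness\<close>

lemma tensor_ket_carrier:
  "tensor (replicate N ket0) \<in> carrier_mat (2 ^ N) 1"
  "tensor (replicate N ket1) \<in> carrier_mat (2 ^ N) 1"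
  using tensor_carrier[of "replicate N ket0" 2 1] tensor_carrier[of "replicate N ket1" 2 1]
    ket_carrier by (auto simp: set_replicate_conv_if)

lemma ghz_ket_carrier: "ghz_ket N \<phi> \<in> carrier_mat (2 ^ N) 1"
  using tensor_ket_carrier by (simp add: ghz_ket_def)

lemma index_ghz_ket:
  assumes "i < 2 ^ N"
  shows "ghz_ket N \<phi> $$ (i, 0) =
    ((if i = 0 then 1 else 0) + (if Suc i = 2 ^ N then cis \<phi> else 0)) / of_real (sqrt 2)"
  using assms tensor_ket_carrier[of N]
  by (simp add: ghz_ket_def index_tensor_ket0 index_tensor_ket1 cis_conv_exp)

lemma ghz_witness_carrier: "ghz_witness N \<phi> \<in> carrier_mat (2 ^ N) (2 ^ N)"
  using ghz_ket_carrier[of N \<phi>] mat_adjoint_carrier[OF ghz_ket_carrier[of N \<phi>]]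
  by (auto simp: ghz_witness_def)

text \<open>The terms are grouped by the settings that produce them: the three diagonal ones come
  from \<open>Z_setting\<close>, the two phases in the corners from the \<open>M_setting\<close>
  family.\<close>

lemma index_ghz_witness:
  assumes "i < 2 ^ N" "j < 2 ^ N"
  shows "ghz_witness N \<phi> $$ (i, j) =
    ((if i = j then 1 else 0) - (if i = 0 \<and> j = 0 then 1 else 0)
      - (if Suc i = 2 ^ N \<and> Suc j = 2 ^ N then 1 else 0)
      - ((if Suc i = 2 ^ N \<and> j = 0 then cis \<phi> else 0) +
         (if i = 0 \<and> Suc j = 2 ^ N then cis (- \<phi>) else 0))) / 2"
proof -
  let ?K = "ghz_ket N \<phi>"
  note K = ghz_ket_carrier[of N \<phi>]
  have "complex_of_real (sqrt 2) * complex_of_real (sqrt 2) = 2"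
    by (metis of_real_mult of_real_numeral real_sqrt_mult_self abs_numeral)
  then have r: "x / complex_of_real (sqrt 2) * (y / complex_of_real (sqrt 2)) = x * y / 2" for x y
    by simp
  have "(?K * mat_adjoint ?K) $$ (i, j) = ?K $$ (i, 0) * cnj (?K $$ (j, 0))"
    using K mat_adjoint_carrier[OF K] assms
    by (simp add: scalar_prod_def index_mat_adjoint[OF K])
  also have "\<dots> = ((if i = 0 then 1 else 0) + (if Suc i = 2 ^ N then cis \<phi> else 0)) *
      cnj ((if j = 0 then 1 else 0) + (if Suc j = 2 ^ N then cis \<phi> else 0)) / 2"
    unfolding index_ghz_ket[OF assms(1)] index_ghz_ket[OF assms(2)]
    by (simp only: complex_cnj_divide complex_cnj_complex_of_real r)
  finally have P: "(?K * mat_adjoint ?K) $$ (i, j) = \<dots>" .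
  have "ghz_witness N \<phi> $$ (i, j) =
      (1 / 2) * (if i = j then 1 else 0) - (?K * mat_adjoint ?K) $$ (i, j)"
    using K mat_adjoint_carrier[OF K] assms by (simp add: ghz_witness_def)
  then show ?thesis
    unfolding P by (auto simp: cis_cnj cis_mult field_simps)
qed

lemma hermitian_ghz_witness: "hermitian (ghz_witness N \<phi>)"
  by (rule hermitianI[OF ghz_witness_carrier]) (auto simp: index_ghz_witness cis_cnj)

text \<open>
  On \<open>\<plusminus>1\<close>-valued outcomes the products of \<open>(1 + s) / 2\<close> and of \<open>(1 - s) / 2\<close> are the
  indicators of the constant outcomes \<open>1\<close> and \<open>-1\<close>.
\<close>

lemma Z_setting_filter:
  assumes "i < 2 ^ N" "j < 2 ^ N"
  shows "(\<Sum>a\<in>outcomes N. of_real ((1 - prod_list (map (\<lambda>s. (1 + s) / 2) a)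
        - prod_list (map (\<lambda>s. (1 - s) / 2) a)) / 2) * outcome_projector (Z_setting N) a $$ (i, j)) =
    ((if i = j then 1 else 0) - (if i = 0 \<and> j = 0 then 1 else 0)
      - (if Suc i = 2 ^ N \<and> Suc j = 2 ^ N then 1 else 0)) / 2"
proof -
  let ?P = "\<lambda>a. outcome_projector (Z_setting N) a $$ (i, j)"
  \<comment> \<open>These are |0><0| and |1><1|, the eigenprojections of \<open>sigma_z\<close> that
    the weights (1 + s)/2 and (1 - s)/2 single out.\<close>
  let ?D0 = "mat 2 2 (\<lambda>(p, q). if p = 0 \<and> q = 0 then 1 else 0 :: complex)"
  let ?D1 = "mat 2 2 (\<lambda>(p, q). if p = Suc 0 \<and> q = Suc 0 then 1 else 0 :: complex)"
  have D0: "tensor (replicate N ?D0) $$ (i, j) = (if i = 0 \<and> j = 0 then 1 else 0)"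
    by (rule index_tensor_corner0[OF _ _ assms]) auto
  have D1: "tensor (replicate N ?D1) $$ (i, j) = (if Suc i = 2 ^ N \<and> Suc j = 2 ^ N then 1 else 0)"
    by (rule index_tensor_corner1[OF _ _ assms]) auto
  \<comment> \<open>The outcome projectors resolve the identity; the constant 1 is written as a
    product so that the general summation lemma applies.\<close>
  have "(\<Sum>a\<in>outcomes N. of_real (prod_list (map (\<lambda>s. 1) a)) * ?P a) = (if i = j then 1 else 0)"
    unfolding Z_setting_def
    by (subst sum_weighted_outcome_projectors[OF sigma_z_carrier one_carrier_mat _ assms])
      (auto simp: index_local_projector[OF sigma_z_carrier] less_2_cases_iff index_sigma_z
        index_tensor_one[OF assms])
  moreover have "(\<Sum>a\<in>outcomes N. of_real (prod_list (map (\<lambda>s. (1 + s) / 2) a)) * ?P a) =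
      (if i = 0 \<and> j = 0 then 1 else 0)"
    unfolding Z_setting_def
    by (subst sum_weighted_outcome_projectors[OF sigma_z_carrier, of ?D0])
      (use assms in \<open>auto simp: index_local_projector[OF sigma_z_carrier] less_2_cases_iff index_sigma_z
        D0\<close>)
  moreover have "(\<Sum>a\<in>outcomes N. of_real (prod_list (map (\<lambda>s. (1 - s) / 2) a)) * ?P a) =
      (if Suc i = 2 ^ N \<and> Suc j = 2 ^ N then 1 else 0)"
    unfolding Z_setting_def
    by (subst sum_weighted_outcome_projectors[OF sigma_z_carrier, of ?D1])
      (use assms in \<open>auto simp: index_local_projector[OF sigma_z_carrier] less_2_cases_iff index_sigma_z
        D1\<close>)
  moreover have "(\<Sum>a\<in>outcomes N. of_real ((1 - prod_list (map (\<lambda>s. (1 + s) / 2) a)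
        - prod_list (map (\<lambda>s. (1 - s) / 2) a)) / 2) * ?P a) =
      ((\<Sum>a\<in>outcomes N. of_real (prod_list (map (\<lambda>s. 1) a)) * ?P a) -
       (\<Sum>a\<in>outcomes N. of_real (prod_list (map (\<lambda>s. (1 + s) / 2) a)) * ?P a) -
       (\<Sum>a\<in>outcomes N. of_real (prod_list (map (\<lambda>s. (1 - s) / 2) a)) * ?P a)) / 2"
    unfolding sum_subtractf[symmetric] sum_divide_distrib
    by (intro sum.cong refl) (simp add: map_replicate_const field_simps)
  ultimately show ?thesis by simp
qed

text \<open>The one-qubit weight \<open>s\<close> gives the spectral decomposition of the observable
  as the difference of its two eigenprojections.\<close>

lemma M_setting_parity:
  assumes "i < 2 ^ N" "j < 2 ^ N"
  shows "(\<Sum>a\<in>outcomes N. of_real (prod_list a) * outcome_projector (M_setting N t) a $$ (i, j)) =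
    tensor (replicate N (equatorial t)) $$ (i, j)"
  using sum_weighted_outcome_projectors[OF equatorial_carrier equatorial_carrier _ assms, of t "\<lambda>s. s" t]
  by (simp add: M_setting_eq index_local_projector[OF equatorial_carrier] field_simps)

section \<open>Distinctness of the settings\<close>

text \<open>One entry of a local observable is \<open>cis t\<close>, whose real part
  \<open>cos t\<close> determines the angle on this interval. At least one qubit is required, since
  otherwise every setting is the empty list.\<close>

lemma M_setting_inj:
  assumes "N > 0"
  shows "inj_on (M_setting N) {0..pi}"
proof (rule inj_onI)
  fix s t assume st: "s \<in> {0..pi}" "t \<in> {0..pi}" and "M_setting N s = M_setting N t"
  then have "equatorial s $$ (Suc 0, 0) = equatorial t $$ (Suc 0, 0)"
    using assms by (simp add: M_setting_eq)
  then have "cos s = cos t" by (simp add: index_equatorial complex_eq_iff)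
  then show "s = t" using st by (simp add: cos_inj_pi)
qed

lemma M_setting_neq_Z_setting:
  assumes "N > 0"
  shows "M_setting N t \<noteq> Z_setting N"
proof
  assume "M_setting N t = Z_setting N"
  then have "equatorial t $$ (0, 0) = sigma_z $$ (0, 0)"
    using assms by (simp add: M_setting_eq Z_setting_def)
  then show False by (simp add: index_equatorial index_sigma_z)
qed

section \<open>Counting the settings and assembling the witness\<close>

theorem theorem1:
  fixes N :: nat and \<theta> :: "nat \<Rightarrow> real" and S :: "complex mat list set"
  assumes "N \<ge> 2"
    and "\<And>k. \<theta> k = real k * pi / real (N + 1)"
    and "S = {Z_setting N} \<union> {M_setting N (\<theta> k) | k. k \<in> {0..N}}"
  shows "card S = N + 2 \<and> (\<forall>Os\<in>S. local_setting N Os) \<and>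
    family_realized_with N S {ghz_witness N \<phi> | \<phi>. \<phi> \<in> UNIV}"
proof -
  have N: "N > 0" using assms(1) by simp
  define M where "M k = M_setting N (\<theta> k)" for k
  have S: "S = insert (Z_setting N) (M ` {..N})"
    unfolding assms(3) M_def by auto
  have notin: "Z_setting N \<notin> M ` {..N}"
    using M_setting_neq_Z_setting[OF N] by (auto simp: M_def dest: sym)
  \<comment> \<open>Injectivity gives the cardinality, and it also lets \<open>k\<close> be
    recovered from its setting when the coefficients are defined.\<close>
  have inj: "inj_on M {..N}"
  proof (rule inj_onI)
    fix k l assume kl: "k \<in> {..N}" "l \<in> {..N}" and eq: "M k = M l"
    have "\<theta> n \<in> {0..pi}" if "n \<le> N" for n
    proof -
      have "pi * real n \<le> pi * real (N + 1)" using that by (intro mult_left_mono) auto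
      then show ?thesis by (simp add: assms(2) field_simps)
    qed
    then have "\<theta> k = \<theta> l"
      using inj_onD[OF M_setting_inj[OF N]] kl eq unfolding M_def by blast
    then show "k = l" by (simp add: assms(2))
  qed
  have "card S = N + 2"
    unfolding S using notin by (simp add: card_image[OF inj])
  moreover have loc: "\<forall>Os\<in>S. local_setting N Os"
    unfolding S M_def using local_setting_Z local_setting_M by auto
  moreover have "realized_with N S (ghz_witness N \<phi>)" for \<phi>
  proof -
    \<comment> \<open>On \<open>Z_setting\<close> the coefficient is half of 1 minus the indicators
      of the two constant outcomes. On the others it is the parity times a cosine: the filtered sum
      is (N + 1)/2 times the corner phases, so division by -(N + 1) leaves the -1/2 of the witness.
      As \<open>c\<close> takes a setting and not an index, \<open>inv_into\<close> retrieves
      \<open>k\<close>.\<close>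
    define c where "c Os a =
      (if Os = Z_setting N
       then (1 - prod_list (map (\<lambda>s. (1 + s) / 2) a) - prod_list (map (\<lambda>s. (1 - s) / 2) a)) / 2
       else - cos (\<phi> - real N * \<theta> (inv_into {..N} M Os)) / real (N + 1) * prod_list a)"
      for Os and a :: "real list"
    define T where "T = (\<lambda>(Os, a). complex_of_real (c Os a) \<cdot>\<^sub>m outcome_projector Os a)"
    have fin: "finite (S \<times> outcomes N)"
      by (simp add: S finite_outcomes)
    have proj: "outcome_projector Os a \<in> carrier_mat (2 ^ N) (2 ^ N)"
      if "Os \<in> S" "a \<in> outcomes N" for Os a
      using outcome_projector_carrier loc that by blast
    have T: "T x \<in> carrier_mat (2 ^ N) (2 ^ N)" if "x \<in> S \<times> outcomes N" for x
      using that proj by (auto simp: T_def)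
    have entry: "ghz_witness N \<phi> $$ (i, j) = (\<Sum>x\<in>S \<times> outcomes N. T x $$ (i, j))"
      if ij: "i < 2 ^ N" "j < 2 ^ N" for i j
    proof -
      let ?F = "\<lambda>Os. \<Sum>a\<in>outcomes N. of_real (c Os a) * outcome_projector Os a $$ (i, j)"
      have "(\<Sum>x\<in>S \<times> outcomes N. T x $$ (i, j)) = (\<Sum>Os\<in>S. ?F Os)"
        unfolding sum.cartesian_product
      proof (intro sum.cong refl)
        fix x assume x: "x \<in> S \<times> outcomes N"
        show "T x $$ (i, j) = (case x of (Os, a) \<Rightarrow>
            of_real (c Os a) * outcome_projector Os a $$ (i, j))"
          using x proj[of "fst x" "snd x"] ij by (cases x) (simp add: T_def)
      qed
      \<comment> \<open>The \<open>Z_setting\<close> is not among the \<open>M k\<close>, and these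
        are distinct, so the sum over the set \<open>S\<close> splits without lost
        multiplicities.\<close>
      also have "\<dots> = ?F (Z_setting N) + (\<Sum>k\<le>N. ?F (M k))"
        unfolding S using notin by (simp add: sum.reindex[OF inj])
      also have "?F (Z_setting N) = ((if i = j then 1 else 0) - (if i = 0 \<and> j = 0 then 1 else 0)
          - (if Suc i = 2 ^ N \<and> Suc j = 2 ^ N then 1 else 0)) / 2"
        using Z_setting_filter[OF ij] by (simp add: c_def)
      also have "(\<Sum>k\<le>N. ?F (M k)) = - (\<Sum>k\<le>N. of_real (cos (\<phi> - real N * \<theta> k)) *
          tensor (replicate N (equatorial (\<theta> k))) $$ (i, j)) / of_nat (N + 1)"
      proof -
        have "?F (M k) = - (of_real (cos (\<phi> - real N * \<theta> k)) *
            tensor (replicate N (equatorial (\<theta> k))) $$ (i, j)) / of_nat (N + 1)" if "k \<in> {..N}" for k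
        proof -
          have "M k \<noteq> Z_setting N"
            using that notin by (metis imageI)
          then have "c (M k) a = - cos (\<phi> - real N * \<theta> k) / real (N + 1) * prod_list a" for a
            using inv_into_f_f[OF inj that] by (simp add: c_def)
          then have "?F (M k) = - of_real (cos (\<phi> - real N * \<theta> k)) / of_nat (N + 1) *
              (\<Sum>a\<in>outcomes N. of_real (prod_list a) * outcome_projector (M k) a $$ (i, j))"
            by (simp add: sum_distrib_left mult.assoc)
          then show ?thesis
            unfolding M_def M_setting_parity[OF ij] by simp
        qed
        then show ?thesis
          by (simp add: sum_negf sum_divide_distrib del: of_nat_Suc of_nat_add)
      qed
      also have "\<dots> = - ((if Suc i = 2 ^ N \<and> j = 0 then cis \<phi> else 0) +
          (if i = 0 \<and> Suc j = 2 ^ N then cis (- \<phi>) else 0)) / 2"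
        unfolding assms(2) sum_equatorial_tensors[OF ij]
        by (simp add: add_divide_distrib del: of_nat_Suc of_nat_add)
      finally show ?thesis
        unfolding index_ghz_witness[OF ij]
        by (simp only: diff_conv_add_uminus add_divide_distrib)
    qed
    let ?sum = "finsum (module_mat TYPE(complex) (2 ^ N) (2 ^ N)) T (S \<times> outcomes N)"
    \<comment> \<open>The entrywise identity lifts to matrices because the \<open>finsum\<close> has
      the same dimensions and entrywise sums.\<close>
    have "ghz_witness N \<phi> = ?sum"
    proof (rule eq_matI)
      note F = finsum_module_mat[of "S \<times> outcomes N" T "2 ^ N" "2 ^ N", OF fin T]
      show "dim_row (ghz_witness N \<phi>) = dim_row ?sum"
        "dim_col (ghz_witness N \<phi>) = dim_col ?sum"
        using ghz_witness_carrier[of N \<phi>] F(1) by auto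
      fix i j
      assume "i < dim_row ?sum"
        "j < dim_col ?sum"
      then have "i < 2 ^ N" "j < 2 ^ N" using F(1) by auto
      then show "ghz_witness N \<phi> $$ (i, j) = ?sum $$ (i, j)"
        using entry F(2) by simp
    qed
    then have "\<exists>c. ghz_witness N \<phi> = finsum (module_mat TYPE(complex) (2 ^ N) (2 ^ N))
        (\<lambda>(Os, a). complex_of_real (c Os a) \<cdot>\<^sub>m outcome_projector Os a) (S \<times> outcomes N)"
      unfolding T_def by blast
    moreover have "finite S" by (simp add: S)
    ultimately show ?thesis
      using loc ghz_witness_carrier hermitian_ghz_witness unfolding realized_with_def by blast
  qed
  ultimately show ?thesis by (auto simp: family_realized_with_def)
qed

end
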